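(* Let $n$ and $r$ be positive integers and let $C_n(r)$ denote the number of $r$-colored partitions $\Lambda$ of $[n]$ with $\mathrm{cr}(\Lambda)<2$ (i.e. with no two crossing arcs of the same color). Let $e_1,\dots,e_r$ be the unit coordinate vectors of $\mathbb{R}^r$. Then $C_n(r)$ equals the number of $(n-1)$-step walks in $\mathbb{N}^r$ (all points having nonnegative integer coordinates) from the origin to itself, where each step is chosen from the following $(r+1)^2$ distinct steps: $\pm e_i$ for $i\in[r]$ ($2r$ steps), $e_i-e_j$ for ordered pairs $i\neq j$ ($r^2-r$ steps), and $r+1$ distinct zero steps.
   Context: For a partition $P$ of $[n]=\{1,\dots,n\}$ (a set of disjoint nonempty blocks with union $[n]$), $\mathrm{Arc}(P)$ is the set of pairs $(i,j)$ with $i,j$ in the same block and $j$ the least element of that block greater than $i$. A sequence of arcs $(i_t,j_t)_{t\in[k]}$ is a $k$-crossing if $i_1<\dots<i_k<j_1<\dots<j_k$. An $r$-colored partition is $\Lambda=(P,\varphi)$ with $\varphi:\mathrm{Arc}(P)\to[r]$; $\mathrm{cr}(\Lambda)$ is the largest $k$ such that $P$ has a $k$-crossing whose arcs all have the same color under $\varphi$. *)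

theory Defs
  imports Main "HOL-Library.Disjoint_Sets" "HOL-Library.FuncSet" "HOL-Library.Function_Algebras"
begin

definition Arc :: "nat set set \<Rightarrow> (nat \<times> nat) set" where
  "Arc P = {(i, j). \<exists>B\<in>P. i \<in> B \<and> j \<in> B \<and> i < j \<and> (\<forall>l\<in>B. i < l \<longrightarrow> j \<le> l)}"

text \<open>A \<open>k\<close>-crossing \<open>(i\<^sub>1, j\<^sub>1), \<dots>, (i\<^sub>k, j\<^sub>k)\<close> is a list of \<open>k\<close> arcs; the chain
  \<open>i\<^sub>1 < \<dots> < i\<^sub>k < j\<^sub>1 < \<dots> < j\<^sub>k\<close> says that the left endpoints followed by the right endpoints
  are strictly increasing. The empty list is a 0-crossing.\<close>

definition is_crossing :: "nat set set \<Rightarrow> nat \<Rightarrow> (nat \<times> nat) list \<Rightarrow> bool" where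
  "is_crossing P k as \<longleftrightarrow>
     length as = k \<and> set as \<subseteq> Arc P \<and> sorted_wrt (<) (map fst as @ map snd as)"

text \<open>Colorings are extensional functions on the arcs, so that distinct functions are
  distinct colorings.\<close>

definition colored_partitions :: "nat \<Rightarrow> nat \<Rightarrow> (nat set set \<times> (nat \<times> nat \<Rightarrow> nat)) set" where
  "colored_partitions n r = {(P, \<phi>). partition_on {1..n} P \<and> \<phi> \<in> Arc P \<rightarrow>\<^sub>E {1..r}}"

definition cr :: "nat set set \<times> (nat \<times> nat \<Rightarrow> nat) \<Rightarrow> nat" where
  "cr \<Lambda> = (case \<Lambda> of (P, \<phi>) \<Rightarrow>
     Max {k. \<exists>as. is_crossing P k as \<and> (\<exists>c. \<forall>a\<in>set as. \<phi> a = c)})"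

definition Cnum :: "nat \<Rightarrow> nat \<Rightarrow> nat" where
  "Cnum n r = card {\<Lambda> \<in> colored_partitions n r. cr \<Lambda> < 2}"

text \<open>Vectors are integer-valued functions whose coordinates outside \<open>{1..r}\<close> vanish; addition
  and zero are pointwise. Steps are labels, separate from their displacement vectors, since
  \<open>r + 1\<close> of them share the displacement 0.\<close>

definition unit_vec :: "nat \<Rightarrow> nat \<Rightarrow> int" where
  "unit_vec i = (\<lambda>k. if k = i then 1 else 0)"

definition orthant :: "nat \<Rightarrow> (nat \<Rightarrow> int) set" where
  "orthant r = {v. (\<forall>k\<in>{1..r}. 0 \<le> v k) \<and> (\<forall>k. k \<notin> {1..r} \<longrightarrow> v k = 0)}"

datatype step = Up nat | Down nat | Exchange nat nat | Stay nat

primrec displacement :: "step \<Rightarrow> nat \<Rightarrow> int" where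
  "displacement (Up i) = unit_vec i"
| "displacement (Down i) = - unit_vec i"
| "displacement (Exchange i j) = unit_vec i - unit_vec j"
| "displacement (Stay c) = 0"

definition steps :: "nat \<Rightarrow> step set" where
  "steps r = Up ` {1..r} \<union> Down ` {1..r}
     \<union> {Exchange i j | i j. i \<in> {1..r} \<and> j \<in> {1..r} \<and> i \<noteq> j} \<union> Stay ` {1..r + 1}"

definition position :: "step list \<Rightarrow> nat \<Rightarrow> nat \<Rightarrow> int" where
  "position w t = sum_list (map displacement (take t w))"

definition closed_walks :: "nat \<Rightarrow> nat \<Rightarrow> step list set" where
  "closed_walks r m = {w. length w = m \<and> set w \<subseteq> steps r \<and>
     (\<forall>t\<le>m. position w t \<in> orthant r) \<and> position w m = 0}"

lemma card_steps: "card (steps r) = (r + 1)\<^sup>2"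
proof -
  let ?E = "{Exchange i j | i j. i \<in> {1..r} \<and> j \<in> {1..r} \<and> i \<noteq> j}"
  have E: "?E = case_prod Exchange ` ({1..r} \<times> {1..r} - (\<lambda>i. (i, i)) ` {1..r})"
    by auto
  have "card ?E = card ({1..r} \<times> {1..r} - (\<lambda>i. (i, i)) ` {1..r})"
    unfolding E by (rule card_image) (auto simp: inj_on_def)
  also have "\<dots> = r * r - r"
    by (subst card_Diff_subset) (auto simp: card_image inj_on_def card_cartesian_product)
  finally have cE: "card ?E = r * r - r" .
  have fE: "finite ?E" unfolding E by simp
  have "card (steps r) = card (Up ` {1..r}) + card (Down ` {1..r}) + card ?E + card (Stay ` {1..r + 1})"
    unfolding steps_def using fE
    by (subst card_Un_disjoint; (auto; fail)?)+
  also have "\<dots> = r + r + (r * r - r) + (r + 1)"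
    using cE by (simp add: card_image inj_on_def)
  also have "\<dots> = (r + 1)\<^sup>2"
    using le_square[of r] by (simp add: power2_eq_square)
  finally show ?thesis .
qed

end

theory Submission
  imports Defs
begin

text \<open>The arcs of a partition form a matching of left endpoints with right endpoints, and any
  such matching comes from exactly one partition. Arcs of the same color never cross iff the arcs
  of each color form a noncrossing matching. Such a matching is determined by its sets of left and
  right endpoints: the first right endpoint has to be matched with the last left endpoint before
  it. Given the two sets, it exists iff they satisfy a ballot condition. So a colored partition
  amounts to recording, for every point, the color (if any) of the arc opening there and of the arc
  closing there. No arc closes at \<open>1\<close> or opens at \<open>n\<close>; pairing the color opening at \<open>t\<close> with the
  color closing at \<open>t + 1\<close> gives the \<open>n - 1\<close> steps of a walk whose coordinates count the open arcs
  of each color, and the ballot conditions say that it is a closed walk in the orthant.\<close>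

section \<open>Noncrossing matchings\<close>

definition arc_diagram :: "('a::linorder \<times> 'a) set \<Rightarrow> bool" where
  "arc_diagram M \<longleftrightarrow> single_valued M \<and> single_valued (M\<inverse>) \<and> (\<forall>(i, j)\<in>M. i < j)"

definition noncrossing :: "('a::linorder \<times> 'a) set \<Rightarrow> bool" where
  "noncrossing M \<longleftrightarrow> (\<forall>i j k l. (i, k) \<in> M \<longrightarrow> (j, l) \<in> M \<longrightarrow> \<not> (i < j \<and> j < k \<and> k < l))"

definition noncrossing_matching :: "'a::linorder set \<Rightarrow> 'a set \<Rightarrow> ('a \<times> 'a) set \<Rightarrow> bool" where
  "noncrossing_matching X Y M \<longleftrightarrow>
     arc_diagram M \<and> noncrossing M \<and> Domain M = X \<and> Range M = Y"

definition ballot :: "'a::linorder set \<Rightarrow> 'a set \<Rightarrow> bool" where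
  "ballot X Y \<longleftrightarrow> finite X \<and> finite Y \<and> card X = card Y \<and>
     (\<forall>t. card (Y \<inter> {..t}) \<le> card (X \<inter> {..<t}))"

lemma arc_diagramD:
  assumes "arc_diagram M"
  shows arc_diagram_less: "(i, j) \<in> M \<Longrightarrow> i < j"
    and arc_diagram_left_unique: "(i, j) \<in> M \<Longrightarrow> (i, k) \<in> M \<Longrightarrow> j = k"
    and arc_diagram_right_unique: "(i, k) \<in> M \<Longrightarrow> (j, k) \<in> M \<Longrightarrow> i = j"
  using assms by (auto simp: arc_diagram_def single_valued_def)

lemma arc_diagram_subset: "arc_diagram M \<Longrightarrow> N \<subseteq> M \<Longrightarrow> arc_diagram N"
  unfolding arc_diagram_def by (meson converse_mono single_valued_subset subsetD)

lemma noncrossing_subset: "noncrossing M \<Longrightarrow> N \<subseteq> M \<Longrightarrow> noncrossing N"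
  unfolding noncrossing_def by blast

lemma noncrossing_insert:
  "noncrossing (insert (x, y) M) \<longleftrightarrow> noncrossing M \<and>
     (\<forall>(i, j)\<in>M. \<not> (i < x \<and> x < j \<and> j < y) \<and> \<not> (x < i \<and> i < y \<and> y < j))"
  unfolding noncrossing_def by auto

lemma arc_diagram_UN:
  assumes diagram: "\<And>c. arc_diagram (M c)"
    and left: "disjoint_family (\<lambda>c. Domain (M c))" and right: "disjoint_family (\<lambda>c. Range (M c))"
  shows "arc_diagram (\<Union>c. M c)"
proof -
  have "c = d" if "(i, j) \<in> M c" "(k, l) \<in> M d" "i = k \<or> j = l" for i j k l c d
    using that disjoint_family_onD[OF left, of c d] disjoint_family_onD[OF right, of c d] by blast
  then show ?thesis
    unfolding arc_diagram_def single_valued_def using arc_diagramD[OF diagram] by fast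
qed

lemma card_Domain_single_valued:
  assumes "single_valued R"
  shows "card (Domain R) = card R"
proof -
  have "inj_on fst R"
    using assms by (auto simp: inj_on_def dest: single_valuedD)
  then show ?thesis
    by (simp add: Domain_fst card_image)
qed

lemma card_Domain_eq_card_Range:
  assumes "arc_diagram M"
  shows "card (Domain M) = card (Range M)"
  using card_Domain_single_valued[of M] card_Domain_single_valued[of "M\<inverse>"] assms
  by (simp add: arc_diagram_def)

lemma noncrossing_matching_imp_ballot:
  assumes M: "noncrossing_matching X Y M" and fin: "finite X" "finite Y"
  shows "ballot X Y"
  unfolding ballot_def
proof (intro conjI allI)
  have diagram: "arc_diagram M" and X: "Domain M = X" and Y: "Range M = Y"
    using M by (auto simp: noncrossing_matching_def)
  show "card X = card Y"
    using card_Domain_eq_card_Range[OF diagram] X Y by simp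
  fix t
  define N where "N = {(i, j) \<in> M. j \<le> t}"
  have "arc_diagram N"
    by (rule arc_diagram_subset[OF diagram]) (auto simp: N_def)
  have "card (Y \<inter> {..t}) = card (Range N)"
    by (rule arg_cong[where f = card]) (auto simp: N_def Y[symmetric])
  also have "\<dots> = card (Domain N)"
    using card_Domain_eq_card_Range[OF \<open>arc_diagram N\<close>] by simp
  also have "\<dots> \<le> card (X \<inter> {..<t})"
    using arc_diagram_less[OF diagram] fin
    by (intro card_mono) (auto simp: N_def X[symmetric] intro: less_le_trans)
  finally show "card (Y \<inter> {..t}) \<le> card (X \<inter> {..<t})" .
qed (fact fin)+

definition first_closing_arc :: "'a::linorder set \<Rightarrow> 'a set \<Rightarrow> 'a \<Rightarrow> 'a \<Rightarrow> bool" where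
  "first_closing_arc X Y x y \<longleftrightarrow>
     x \<in> X \<and> y \<in> Y \<and> x < y \<and> (\<forall>y'\<in>Y. y \<le> y') \<and> (\<forall>x'\<in>X. x' < y \<longrightarrow> x' \<le> x)"

lemma ballot_ex_first_closing_arc:
  assumes "ballot X Y" and "Y \<noteq> {}"
  obtains x y where "first_closing_arc X Y x y"
proof -
  have fin: "finite X" "finite Y"
    using assms(1) by (auto simp: ballot_def)
  define y where "y = Min Y"
  define x where "x = Max (X \<inter> {..<y})"
  have y: "y \<in> Y" "\<forall>y'\<in>Y. y \<le> y'"
    using fin assms(2) by (auto simp: y_def)
  have "0 < card (Y \<inter> {..y})"
    using y(1) fin by (auto simp: card_gt_0_iff)
  also have "\<dots> \<le> card (X \<inter> {..<y})"
    using assms(1) by (simp add: ballot_def)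
  finally have "X \<inter> {..<y} \<noteq> {}"
    by auto
  then have "x \<in> X \<inter> {..<y}" "\<forall>x'\<in>X. x' < y \<longrightarrow> x' \<le> x"
    using fin Max_in[of "X \<inter> {..<y}"] by (auto simp: x_def)
  then show thesis
    using y that by (auto simp: first_closing_arc_def)
qed

lemma ballot_remove_first_closing_arc:
  assumes "ballot X Y" and "first_closing_arc X Y x y"
  shows "ballot (X - {x}) (Y - {y})"
proof -
  have fin: "finite X" "finite Y" and card: "card X = card Y"
    and le: "\<And>t. card (Y \<inter> {..t}) \<le> card (X \<inter> {..<t})"
    using assms(1) by (auto simp: ballot_def)
  have xy: "x \<in> X" "y \<in> Y" "x < y" and y_le: "\<And>y'. y' \<in> Y \<Longrightarrow> y \<le> y'"
    using assms(2) by (auto simp: first_closing_arc_def)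
  have "card ((Y - {y}) \<inter> {..t}) \<le> card ((X - {x}) \<inter> {..<t})" for t
  proof (cases "y \<le> t")
    case True
    then have "x \<in> X \<inter> {..<t}" "y \<in> Y \<inter> {..t}"
      using xy by auto
    then show ?thesis
      using le[of t] by (simp add: Int_Diff[symmetric] Diff_Int_distrib2 card_Diff_singleton)
  next
    case False
    then have "Y \<inter> {..t} = {}"
      using y_le by force
    then show ?thesis
      by (simp add: Diff_Int_distrib2)
  qed
  then show ?thesis
    using fin card xy by (simp add: ballot_def)
qed

lemma first_closing_arc_in_noncrossing_matching:
  assumes M: "noncrossing_matching X Y M" and first: "first_closing_arc X Y x y"
  shows "(x, y) \<in> M"
proof -
  have diagram: "arc_diagram M" and nc: "noncrossing M" and X: "Domain M = X" and Y: "Range M = Y"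
    using M by (auto simp: noncrossing_matching_def)
  have xy: "x \<in> X" "y \<in> Y" "x < y" and y_le: "\<And>y'. y' \<in> Y \<Longrightarrow> y \<le> y'"
    and le_x: "\<And>x'. x' \<in> X \<Longrightarrow> x' < y \<Longrightarrow> x' \<le> x"
    using first by (auto simp: first_closing_arc_def)
  obtain i where i: "(i, y) \<in> M" using xy(2) Y by blast
  obtain l where l: "(x, l) \<in> M" using xy(1) X by blast
  have "i \<le> x"
    using i X le_x arc_diagram_less[OF diagram i] by blast
  moreover have "y \<le> l"
    using l Y y_le by blast
  ultimately have "i = x \<or> y = l"
    using nc i l xy(3) unfolding noncrossing_def by (metis order.not_eq_order_implies_strict)
  then show ?thesis
    using i l by blast
qed

lemma noncrossing_matching_Diff:
  assumes M: "noncrossing_matching X Y M" and xy: "(x, y) \<in> M"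
  shows "noncrossing_matching (X - {x}) (Y - {y}) (M - {(x, y)})"
proof -
  have diagram: "arc_diagram M"
    using M by (simp add: noncrossing_matching_def)
  have "Domain (M - {(x, y)}) = Domain M - {x}" "Range (M - {(x, y)}) = Range M - {y}"
    using xy arc_diagram_left_unique[OF diagram] arc_diagram_right_unique[OF diagram] by blast+
  then show ?thesis
    using M arc_diagram_subset[OF diagram] noncrossing_subset[of M]
    by (simp add: noncrossing_matching_def)
qed

lemma noncrossing_matching_insert_first_closing_arc:
  assumes M: "noncrossing_matching (X - {x}) (Y - {y}) M" and first: "first_closing_arc X Y x y"
  shows "noncrossing_matching X Y (insert (x, y) M)"
proof -
  have diagram: "arc_diagram M" and nc: "noncrossing M"
    and X: "Domain M = X - {x}" and Y: "Range M = Y - {y}"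
    using M by (auto simp: noncrossing_matching_def)
  have xy: "x \<in> X" "y \<in> Y" "x < y"
    using first by (auto simp: first_closing_arc_def)
  have before_x: "i \<le> x" if "(i, j) \<in> M" "i < y" for i j
    using that first X by (auto simp: first_closing_arc_def)
  have after_y: "y \<le> j" if "(i, j) \<in> M" for i j
    using that first Y by (auto simp: first_closing_arc_def)
  have "(x, j) \<notin> M" "(i, y) \<notin> M" for i j
    using X Y by blast+
  then have "arc_diagram (insert (x, y) M)"
    using diagram xy(3) by (auto simp: arc_diagram_def single_valued_def)
  moreover have "noncrossing (insert (x, y) M)"
    unfolding noncrossing_insert using nc before_x after_y by (fastforce simp: not_less)
  moreover have "Domain (insert (x, y) M) = X" "Range (insert (x, y) M) = Y"
    using X Y xy by auto
  ultimately show ?thesis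
    by (simp add: noncrossing_matching_def)
qed

theorem ballot_ex1_noncrossing_matching:
  assumes "ballot X Y"
  shows "\<exists>!M. noncrossing_matching X Y M"
  using assms
proof (induction "card Y" arbitrary: X Y)
  case 0
  then have "X = {}" "Y = {}"
    by (auto simp: ballot_def)
  moreover have "noncrossing_matching {} {} M \<longleftrightarrow> M = {}" for M :: "('a \<times> 'a) set"
    by (auto simp: noncrossing_matching_def arc_diagram_def noncrossing_def Domain_empty_iff)
  ultimately show ?case
    by simp
next
  case (Suc m)
  then have "Y \<noteq> {}"
    by auto
  then obtain x y where first: "first_closing_arc X Y x y"
    using ballot_ex_first_closing_arc Suc.prems by blast
  have "m = card (Y - {y})"
    using Suc.hyps(2) first by (simp add: first_closing_arc_def)
  then have "\<exists>!N. noncrossing_matching (X - {x}) (Y - {y}) N"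
    using Suc.hyps(1) ballot_remove_first_closing_arc[OF Suc.prems first] by blast
  then obtain N where N: "noncrossing_matching (X - {x}) (Y - {y}) N"
    and unique: "\<And>N'. noncrossing_matching (X - {x}) (Y - {y}) N' \<Longrightarrow> N' = N"
    by blast
  show ?case
  proof (rule ex1I)
    show "noncrossing_matching X Y (insert (x, y) N)"
      by (rule noncrossing_matching_insert_first_closing_arc[OF N first])
  next
    fix M assume M: "noncrossing_matching X Y M"
    have xy: "(x, y) \<in> M"
      by (rule first_closing_arc_in_noncrossing_matching[OF M first])
    then have "M - {(x, y)} = N"
      using unique noncrossing_matching_Diff[OF M] by blast
    then show "M = insert (x, y) N"
      using xy by blast
  qed
qed

section \<open>Partitions and arc diagrams\<close>

definition connectivity :: "'a set \<Rightarrow> ('a \<times> 'a) set \<Rightarrow> ('a \<times> 'a) set" where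
  "connectivity S A = (A \<union> A\<inverse>)\<^sup>* \<inter> S \<times> S"

lemma equiv_connectivity: "equiv S (connectivity S A)"
proof (rule equivI)
  have "sym ((A \<union> A\<inverse>)\<^sup>*)"
    by (intro sym_rtrancl sym_Un_converse)
  then show "sym (connectivity S A)"
    by (auto simp: connectivity_def sym_def)
qed (auto simp: connectivity_def refl_on_def intro: transI rtrancl_trans)

lemma rtrancl_Un_converse_single_valued:
  assumes "single_valued A" and "single_valued (A\<inverse>)"
  shows "(A \<union> A\<inverse>)\<^sup>* = A\<^sup>* \<union> (A\<^sup>*)\<inverse>"
proof
  show "(A \<union> A\<inverse>)\<^sup>* \<subseteq> A\<^sup>* \<union> (A\<^sup>*)\<inverse>"
  proof (rule subrelI)
    fix x z assume "(x, z) \<in> (A \<union> A\<inverse>)\<^sup>*"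
    then show "(x, z) \<in> A\<^sup>* \<union> (A\<^sup>*)\<inverse>"
    proof (induction rule: rtrancl_induct)
      case (step y z)
      have "(x, z) \<in> A\<^sup>* \<union> (A\<^sup>*)\<inverse>" if "(y, x) \<in> A\<^sup>*" "(y, z) \<in> A"
        using single_valued_confluent[OF assms(1) that(1), of z] that(2) by blast
      moreover have "(x, z) \<in> A\<^sup>* \<union> (A\<^sup>*)\<inverse>" if "(x, y) \<in> A\<^sup>*" "(z, y) \<in> A"
        using single_valued_confluent[OF assms(2), of y x z] that
        by (auto simp: rtrancl_converse)
      ultimately show ?case
        using step by (auto intro: rtrancl_into_rtrancl converse_rtrancl_into_rtrancl)
    qed simp
  qed
  show "A\<^sup>* \<union> (A\<^sup>*)\<inverse> \<subseteq> (A \<union> A\<inverse>)\<^sup>*"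
    using rtrancl_Un_subset[of A "A\<inverse>"] by (simp add: rtrancl_converse)
qed

lemma Arc_quotient_iff:
  assumes E: "equiv S E"
  shows "(i, j) \<in> Arc (S // E) \<longleftrightarrow> (i, j) \<in> E \<and> i < j \<and> (\<forall>l. (i, l) \<in> E \<longrightarrow> i < l \<longrightarrow> j \<le> l)"
proof -
  have "B \<in> S // E \<and> i \<in> B \<longleftrightarrow> i \<in> S \<and> B = E `` {i}" for B
    using E by (metis equiv_class_self quotientI Image_singleton_iff equiv_class_eq_iff quotientE)
  moreover have "i \<in> S" if "(i, j) \<in> E"
    using that E by (auto simp: equiv_def)
  ultimately show ?thesis
    unfolding Arc_def by blast
qed

lemma arc_diagram_Arc_quotient:
  assumes E: "equiv S E"
  shows "arc_diagram (Arc (S // E))"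
proof -
  note Arc_iff = Arc_quotient_iff[OF E]
  have "j = k" if "(i, j) \<in> Arc (S // E)" "(i, k) \<in> Arc (S // E)" for i j k
    using that by (simp add: Arc_iff le_antisym)
  moreover have "i = j" if "(i, k) \<in> Arc (S // E)" "(j, k) \<in> Arc (S // E)" for i j k
  proof -
    have "(i, j) \<in> E" "(j, i) \<in> E"
      using that E unfolding Arc_iff equiv_def by (meson symD transD)+
    then show ?thesis
      using that by (metis Arc_iff leD linorder_neqE_nat)
  qed
  ultimately show ?thesis
    by (auto simp: arc_diagram_def single_valued_def Arc_iff)
qed

lemma equiv_imp_rtrancl_Arc_quotient:
  assumes E: "equiv S E" and "(i, j) \<in> E" and "i \<le> j"
  shows "(i, j) \<in> (Arc (S // E))\<^sup>*"
  using assms(2,3)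
proof (induction "j - i" arbitrary: i rule: less_induct)
  case less
  show ?case
  proof (cases "i = j")
    case False
    then have j: "(i, j) \<in> E \<and> i < j"
      using less.prems by simp
    define k where "k = (LEAST l. (i, l) \<in> E \<and> i < l)"
    have k: "(i, k) \<in> E \<and> i < k"
      unfolding k_def by (rule LeastI, rule j)
    have k_le: "k \<le> l" if "(i, l) \<in> E" "i < l" for l
      unfolding k_def using that by (simp add: Least_le)
    have "(i, k) \<in> Arc (S // E)"
      using k k_le by (simp add: Arc_quotient_iff[OF E])
    moreover have "(k, j) \<in> E"
      using j k E unfolding equiv_def by (meson symD transD)
    then have "(k, j) \<in> (Arc (S // E))\<^sup>*"
      using less.hyps[of k] k k_le[of j] j by (simp add: diff_less_mono2)
    ultimately show ?thesis
      by (rule converse_rtrancl_into_rtrancl)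
  qed simp
qed

lemma connectivity_Arc_quotient:
  assumes E: "equiv S E"
  shows "connectivity S (Arc (S // E)) = E"
proof -
  have E_sub: "E \<subseteq> S \<times> S" and "refl_on S E" "sym E" "trans E"
    using E by (auto simp: equiv_def)
  show ?thesis
  proof (intro subset_antisym subrelI)
    fix i j assume "(i, j) \<in> connectivity S (Arc (S // E))"
    then have "i \<in> S" and "(i, j) \<in> (Arc (S // E) \<union> (Arc (S // E))\<inverse>)\<^sup>*"
      by (auto simp: connectivity_def)
    from this(2) show "(i, j) \<in> E"
    proof (induction rule: rtrancl_induct)
      case base
      show ?case using \<open>refl_on S E\<close> \<open>i \<in> S\<close> by (rule refl_onD)
    next
      case (step j k)
      then have "(j, k) \<in> E"
        using \<open>sym E\<close> by (auto simp: Arc_quotient_iff[OF E] dest: symD)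
      then show ?case using step.IH \<open>trans E\<close> by (blast dest: transD)
    qed
  next
    fix i j assume ij: "(i, j) \<in> E"
    then have "(j, i) \<in> E"
      using \<open>sym E\<close> by (blast dest: symD)
    then have "(i, j) \<in> (Arc (S // E))\<^sup>* \<union> ((Arc (S // E))\<^sup>*)\<inverse>"
      using ij equiv_imp_rtrancl_Arc_quotient[OF E] nat_le_linear[of i j] by blast
    then show "(i, j) \<in> connectivity S (Arc (S // E))"
      using ij E_sub rtrancl_Un_subset[of "Arc (S // E)" "(Arc (S // E))\<inverse>"]
      by (auto simp: connectivity_def rtrancl_converse)
  qed
qed

lemma connectivity_less_iff:
  fixes A :: "('a::linorder \<times> 'a) set"
  assumes A: "arc_diagram A" "A \<subseteq> S \<times> S" and "i < j"
  shows "(i, j) \<in> connectivity S A \<longleftrightarrow> (i, j) \<in> A\<^sup>+"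
proof -
  have "x \<le> y" if "(x, y) \<in> A\<^sup>*" for x y
    using that by induction (auto dest: arc_diagram_less[OF A(1)])
  then have "(j, i) \<notin> A\<^sup>*"
    using \<open>i < j\<close> leD by blast
  moreover have "i \<in> S \<and> j \<in> S" if "(i, j) \<in> A\<^sup>+"
    using that trancl_subset_Sigma[OF A(2)] by blast
  moreover have "(A \<union> A\<inverse>)\<^sup>* = A\<^sup>* \<union> (A\<^sup>*)\<inverse>"
    using A(1) by (intro rtrancl_Un_converse_single_valued) (auto simp: arc_diagram_def)
  ultimately show ?thesis
    using \<open>i < j\<close> by (auto simp: connectivity_def rtrancl_eq_or_trancl)
qed

lemma Arc_quotient_connectivity:
  assumes A: "arc_diagram A" "A \<subseteq> S \<times> S"
  shows "Arc (S // connectivity S A) = A"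
proof -
  have trancl_less: "i < j" if "(i, j) \<in> A\<^sup>+" for i j
    using that by induction (auto dest: arc_diagram_less[OF A(1)])
  have "(i, j) \<in> Arc (S // connectivity S A) \<longleftrightarrow>
      (i, j) \<in> A\<^sup>+ \<and> (\<forall>l. (i, l) \<in> A\<^sup>+ \<longrightarrow> j \<le> l)" for i j
    unfolding Arc_quotient_iff[OF equiv_connectivity]
    using connectivity_less_iff[OF A] trancl_less by blast
  moreover have "(i, j) \<in> A\<^sup>+ \<and> (\<forall>l. (i, l) \<in> A\<^sup>+ \<longrightarrow> j \<le> l) \<longleftrightarrow> (i, j) \<in> A" for i j
  proof -
    have first_step: "k \<le> l" if k: "(i, k) \<in> A" and l: "(i, l) \<in> A\<^sup>+" for k l
    proof -
      obtain k' where "(i, k') \<in> A" "(k', l) \<in> A\<^sup>*"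
        using tranclD[OF l] by blast
      then show ?thesis
        using k arc_diagram_left_unique[OF A(1)] trancl_less
        by (metis le_less rtrancl_eq_or_trancl)
    qed
    show ?thesis
    proof (intro iffI conjI allI impI)
      assume j: "(i, j) \<in> A\<^sup>+ \<and> (\<forall>l. (i, l) \<in> A\<^sup>+ \<longrightarrow> j \<le> l)"
      then obtain k where k: "(i, k) \<in> A"
        by (blast dest: tranclD)
      then have "j = k"
        using j first_step by (intro antisym) auto
      then show "(i, j) \<in> A"
        using k by simp
    qed (use first_step in auto)
  qed
  ultimately show ?thesis by auto
qed

lemma arc_diagram_Arc: "partition_on S P \<Longrightarrow> arc_diagram (Arc P)"
  by (auto simp: partition_on_alt intro: arc_diagram_Arc_quotient)

lemma Arc_subset: "partition_on S P \<Longrightarrow> Arc P \<subseteq> S \<times> S"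
  by (auto simp: Arc_def dest: partition_onD1)

theorem bij_betw_Arc:
  "bij_betw Arc {P. partition_on S P} {A. arc_diagram A \<and> A \<subseteq> S \<times> S}"
proof (rule bij_betw_byWitness[where f' = "\<lambda>A. S // connectivity S A"])
  show "\<forall>P\<in>{P. partition_on S P}. S // connectivity S (Arc P) = P"
    by (auto simp: partition_on_alt connectivity_Arc_quotient)
  show "\<forall>A\<in>{A. arc_diagram A \<and> A \<subseteq> S \<times> S}. Arc (S // connectivity S A) = A"
    by (simp add: Arc_quotient_connectivity)
  show "Arc ` {P. partition_on S P} \<subseteq> {A. arc_diagram A \<and> A \<subseteq> S \<times> S}"
    using arc_diagram_Arc Arc_subset by blast
  show "(\<lambda>A. S // connectivity S A) ` {A. arc_diagram A \<and> A \<subseteq> S \<times> S} \<subseteq> {P. partition_on S P}"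
    using partition_on_quotient equiv_connectivity by auto
qed

section \<open>Color classes\<close>

definition color_class :: "nat set set \<times> (nat \<times> nat \<Rightarrow> nat) \<Rightarrow> nat \<Rightarrow> (nat \<times> nat) set" where
  "color_class \<Lambda> c = {a \<in> Arc (fst \<Lambda>). snd \<Lambda> a = c}"

lemma is_crossing_le_card:
  assumes "partition_on S P" and "finite S" and as: "is_crossing P k as"
  shows "k \<le> card S"
proof -
  have "distinct (map fst as)"
    using as by (simp add: is_crossing_def sorted_wrt_append strict_sorted_iff)
  moreover have "set (map fst as) \<subseteq> S"
    using as Arc_subset[OF assms(1)] by (auto simp: is_crossing_def)
  ultimately have "length (map fst as) \<le> card S"
    using assms(2) by (metis card_mono distinct_card)
  then show ?thesis
    using as by (simp add: is_crossing_def)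
qed

lemma noncrossing_color_class_iff:
  "noncrossing (color_class (P, \<phi>) c) \<longleftrightarrow>
     (\<forall>k as. is_crossing P k as \<longrightarrow> (\<forall>a\<in>set as. \<phi> a = c) \<longrightarrow> k < 2)"
proof (intro iffI allI impI)
  fix k as
  assume nc: "noncrossing (color_class (P, \<phi>) c)"
    and as: "is_crossing P k as" "\<forall>a\<in>set as. \<phi> a = c"
  show "k < 2"
  proof (rule ccontr)
    assume "\<not> k < 2"
    then obtain i k j l bs where "as = (i, k) # (j, l) # bs"
      using as(1) unfolding is_crossing_def
      by (cases as rule: list.exhaust; cases "tl as") auto
    then have "(i, k) \<in> color_class (P, \<phi>) c" "(j, l) \<in> color_class (P, \<phi>) c"
      "i < j" "j < k" "k < l"
      using as by (auto simp: is_crossing_def color_class_def sorted_wrt_append)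
    then show False
      using nc by (auto simp: noncrossing_def)
  qed
next
  assume small: "\<forall>k as. is_crossing P k as \<longrightarrow> (\<forall>a\<in>set as. \<phi> a = c) \<longrightarrow> k < 2"
  show "noncrossing (color_class (P, \<phi>) c)"
    unfolding noncrossing_def
  proof (intro allI impI notI)
    fix i j k l
    assume "(i, k) \<in> color_class (P, \<phi>) c" "(j, l) \<in> color_class (P, \<phi>) c" "i < j \<and> j < k \<and> k < l"
    then have "is_crossing P 2 [(i, k), (j, l)]" "\<forall>a\<in>set [(i, k), (j, l)]. \<phi> a = c"
      by (auto simp: is_crossing_def color_class_def)
    then show False
      using small by blast
  qed
qed

lemma cr_less_2_iff:
  assumes "partition_on S P" and "finite S"
  shows "cr (P, \<phi>) < 2 \<longleftrightarrow> (\<forall>c. noncrossing (color_class (P, \<phi>) c))"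
proof -
  define K where "K = {k. \<exists>as. is_crossing P k as \<and> (\<exists>c. \<forall>a\<in>set as. \<phi> a = c)}"
  have "finite K"
    using is_crossing_le_card[OF assms] by (auto simp: K_def finite_nat_set_iff_bounded_le)
  moreover have "is_crossing P 0 []"
    by (simp add: is_crossing_def)
  then have "K \<noteq> {}"
    by (force simp: K_def)
  ultimately have "cr (P, \<phi>) < 2 \<longleftrightarrow> (\<forall>k\<in>K. k < 2)"
    by (simp add: cr_def K_def[symmetric])
  then show ?thesis
    by (auto simp: K_def noncrossing_color_class_iff)
qed

lemma inj_on_color_class: "inj_on color_class (colored_partitions n r)"
proof (rule inj_onI)
  fix \<Lambda> \<Lambda>'
  assume \<Lambda>: "\<Lambda> \<in> colored_partitions n r" "\<Lambda>' \<in> colored_partitions n r"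
    and eq: "color_class \<Lambda> = color_class \<Lambda>'"
  obtain P \<phi> Q \<psi> where [simp]: "\<Lambda> = (P, \<phi>)" "\<Lambda>' = (Q, \<psi>)"
    by fastforce
  have iff: "a \<in> Arc P \<and> \<phi> a = c \<longleftrightarrow> a \<in> Arc Q \<and> \<psi> a = c" for a c
    using eq by (auto simp: color_class_def fun_eq_iff)
  then have "Arc P = Arc Q"
    by blast
  then have "P = Q"
    using \<Lambda> inj_onD[OF bij_betw_imp_inj_on[OF bij_betw_Arc[of "{1..n}"]], of P Q]
    by (simp add: colored_partitions_def)
  moreover have "\<phi> = \<psi>"
  proof (rule PiE_ext)
    show "\<phi> \<in> Arc P \<rightarrow>\<^sub>E {1..r}" "\<psi> \<in> Arc P \<rightarrow>\<^sub>E {1..r}"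
      using \<Lambda> \<open>P = Q\<close> by (simp_all add: colored_partitions_def)
    show "\<phi> a = \<psi> a" if "a \<in> Arc P" for a
      using iff that by metis
  qed
  ultimately show "\<Lambda> = \<Lambda>'"
    by simp
qed

definition family_index :: "('i \<Rightarrow> 'a set) \<Rightarrow> 'a \<Rightarrow> 'i option" where
  "family_index D x = (if x \<in> \<Union> (range D) then Some (THE i. x \<in> D i) else None)"

lemma vimage_family_index:
  assumes "disjoint_family D"
  shows "family_index D -` {Some i} = D i"
proof -
  have "j = k" if "x \<in> D j" "x \<in> D k" for x j k
    using that disjoint_family_onD[OF assms UNIV_I UNIV_I, of j k] by blast
  then have "(THE j. x \<in> D j) = k" if "x \<in> D k" for x k
    using that by (intro the_equality)
  then show ?thesis
    by (auto simp: family_index_def split: if_splits)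
qed

lemma option_fun_eqI:
  fixes f g :: "'a \<Rightarrow> 'b option"
  assumes "\<And>b. f -` {Some b} = g -` {Some b}"
  shows "f = g"
proof
  fix x
  have "f x = Some b \<longleftrightarrow> g x = Some b" for b
    using assms[of b] by blast
  then show "f x = g x"
    by (metis option.exhaust)
qed

lemma ex_colored_partition_color_class:
  assumes diagram: "\<And>c. arc_diagram (M c)" and sub: "\<And>c. M c \<subseteq> {1..n} \<times> {1..n}"
    and colors: "\<And>c. M c \<noteq> {} \<Longrightarrow> c \<in> {1..r}"
    and left: "disjoint_family (\<lambda>c. Domain (M c))" and right: "disjoint_family (\<lambda>c. Range (M c))"
  obtains \<Lambda> where "\<Lambda> \<in> colored_partitions n r" and "color_class \<Lambda> = M"
proof -
  define A where "A = (\<Union>c. M c)"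
  have "arc_diagram A"
    unfolding A_def by (rule arc_diagram_UN[OF diagram left right])
  moreover have "A \<subseteq> {1..n} \<times> {1..n}"
    using sub by (auto simp: A_def)
  ultimately have "A \<in> Arc ` {P. partition_on {1..n} P}"
    unfolding bij_betw_imp_surj_on[OF bij_betw_Arc] by simp
  then obtain P where P: "partition_on {1..n} P" "Arc P = A"
    by auto
  define \<phi> where "\<phi> = (\<lambda>a\<in>A. the (family_index M a))"
  have "disjoint_family M"
    using left by (auto simp: disjoint_family_on_def)
  then have "family_index M a = Some c" if "a \<in> M c" for a c
    using vimage_family_index[of M c] that by blast
  then have \<phi>: "\<phi> a = c" if "a \<in> M c" for a c
    using that by (auto simp: \<phi>_def A_def)
  have "\<phi> \<in> Arc P \<rightarrow>\<^sub>E {1..r}"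
  proof (rule PiE_I)
    fix a assume "a \<in> Arc P"
    then obtain c where "a \<in> M c"
      using P(2) by (auto simp: A_def)
    then show "\<phi> a \<in> {1..r}"
      using \<phi> colors[of c] by auto
  qed (simp add: \<phi>_def P(2))
  then have "(P, \<phi>) \<in> colored_partitions n r"
    using P by (simp add: colored_partitions_def)
  moreover have "color_class (P, \<phi>) c = M c" for c
    using \<phi> P(2) by (auto simp: color_class_def A_def)
  ultimately show thesis
    by (intro that) auto
qed

section \<open>Opening and closing colors\<close>

definition opening_color :: "nat set set \<times> (nat \<times> nat \<Rightarrow> nat) \<Rightarrow> nat \<Rightarrow> nat option" where
  "opening_color \<Lambda> = family_index (\<lambda>c. Domain (color_class \<Lambda> c))"

definition closing_color :: "nat set set \<times> (nat \<times> nat \<Rightarrow> nat) \<Rightarrow> nat \<Rightarrow> nat option" where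
  "closing_color \<Lambda> = family_index (\<lambda>c. Range (color_class \<Lambda> c))"

definition noncrossing_colored_partitions ::
  "nat \<Rightarrow> nat \<Rightarrow> (nat set set \<times> (nat \<times> nat \<Rightarrow> nat)) set" where
  "noncrossing_colored_partitions n r = {\<Lambda> \<in> colored_partitions n r. cr \<Lambda> < 2}"

definition ballot_labelings ::
  "nat \<Rightarrow> nat \<Rightarrow> ((nat \<Rightarrow> nat option) \<times> (nat \<Rightarrow> nat option)) set" where
  "ballot_labelings n r = {(f, g).
     dom f \<subseteq> {1..<n} \<and> ran f \<subseteq> {1..r} \<and> dom g \<subseteq> {2..n} \<and> ran g \<subseteq> {1..r} \<and>
     (\<forall>c. ballot (f -` {Some c}) (g -` {Some c}))}"

lemma
  assumes "\<Lambda> \<in> colored_partitions n r"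
  shows arc_diagram_color_class: "arc_diagram (color_class \<Lambda> c)"
    and vimage_opening_color: "opening_color \<Lambda> -` {Some c} = Domain (color_class \<Lambda> c)"
    and vimage_closing_color: "closing_color \<Lambda> -` {Some c} = Range (color_class \<Lambda> c)"
proof -
  obtain P \<phi> where \<Lambda>: "\<Lambda> = (P, \<phi>)" and P: "partition_on {1..n} P"
    using assms by (auto simp: colored_partitions_def)
  have diagram: "arc_diagram (Arc P)"
    by (rule arc_diagram_Arc[OF P])
  then show "arc_diagram (color_class \<Lambda> c)"
    by (rule arc_diagram_subset) (auto simp: color_class_def \<Lambda>)
  have "disjoint_family (\<lambda>c. Domain (color_class \<Lambda> c))"
    using arc_diagram_left_unique[OF diagram]
    by (auto simp: disjoint_family_on_def color_class_def \<Lambda>)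
  then show "opening_color \<Lambda> -` {Some c} = Domain (color_class \<Lambda> c)"
    unfolding opening_color_def by (rule vimage_family_index)
  have "disjoint_family (\<lambda>c. Range (color_class \<Lambda> c))"
    using arc_diagram_right_unique[OF diagram]
    by (auto simp: disjoint_family_on_def color_class_def \<Lambda>)
  then show "closing_color \<Lambda> -` {Some c} = Range (color_class \<Lambda> c)"
    unfolding closing_color_def by (rule vimage_family_index)
qed

lemma color_class_bounds:
  assumes \<Lambda>: "\<Lambda> \<in> colored_partitions n r" and ij: "(i, j) \<in> color_class \<Lambda> c"
  shows "1 \<le> i \<and> i < j \<and> j \<le> n \<and> c \<in> {1..r}"
proof -
  obtain P \<phi> where "\<Lambda> = (P, \<phi>)" "partition_on {1..n} P" "\<phi> \<in> Arc P \<rightarrow>\<^sub>E {1..r}"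
    using \<Lambda> by (auto simp: colored_partitions_def)
  then have "i \<in> {1..n}" "j \<in> {1..n}" "c \<in> {1..r}"
    using ij Arc_subset[of "{1..n}" P] by (auto simp: color_class_def)
  then show ?thesis
    using arc_diagram_less[OF arc_diagram_color_class[OF \<Lambda>] ij] by simp
qed

lemma noncrossing_matching_color_class:
  assumes "\<Lambda> \<in> noncrossing_colored_partitions n r"
  shows "noncrossing_matching
    (opening_color \<Lambda> -` {Some c}) (closing_color \<Lambda> -` {Some c}) (color_class \<Lambda> c)"
proof -
  have \<Lambda>: "\<Lambda> \<in> colored_partitions n r" and cr: "cr \<Lambda> < 2"
    using assms by (auto simp: noncrossing_colored_partitions_def)
  then obtain P \<phi> where "\<Lambda> = (P, \<phi>)" "partition_on {1..n} P"
    by (auto simp: colored_partitions_def)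
  then have "noncrossing (color_class \<Lambda> c)"
    using cr cr_less_2_iff[of "{1..n}" P \<phi>] by simp
  then show ?thesis
    by (simp add: noncrossing_matching_def arc_diagram_color_class[OF \<Lambda>]
        vimage_opening_color[OF \<Lambda>] vimage_closing_color[OF \<Lambda>])
qed

lemma opening_closing_color_in_ballot_labelings:
  assumes "\<Lambda> \<in> noncrossing_colored_partitions n r"
  shows "(opening_color \<Lambda>, closing_color \<Lambda>) \<in> ballot_labelings n r"
proof -
  have \<Lambda>: "\<Lambda> \<in> colored_partitions n r"
    using assms by (simp add: noncrossing_colored_partitions_def)
  have opening_range: "i \<in> {1..<n} \<and> c \<in> {1..r}" if "opening_color \<Lambda> i = Some c" for i c
    using that vimage_opening_color[OF \<Lambda>, of c] color_class_bounds[OF \<Lambda>, of i _ c] by fastforce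
  have closing_range: "j \<in> {2..n} \<and> c \<in> {1..r}" if "closing_color \<Lambda> j = Some c" for j c
    using that vimage_closing_color[OF \<Lambda>, of c] color_class_bounds[OF \<Lambda>, of _ j c] by fastforce
  have sub: "opening_color \<Lambda> -` {Some c} \<subseteq> {1..<n}" "closing_color \<Lambda> -` {Some c} \<subseteq> {2..n}" for c
    using opening_range closing_range by blast+
  have "finite (opening_color \<Lambda> -` {Some c})" "finite (closing_color \<Lambda> -` {Some c})" for c
    using finite_subset[OF sub(1)] finite_subset[OF sub(2)] by simp_all
  then have "ballot (opening_color \<Lambda> -` {Some c}) (closing_color \<Lambda> -` {Some c})" for c
    using noncrossing_matching_imp_ballot[OF noncrossing_matching_color_class[OF assms]] by blast
  then show ?thesis
    using opening_range closing_range by (auto simp: ballot_labelings_def ran_def subset_iff)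
qed

lemma ex_noncrossing_colored_partition:
  assumes "(f, g) \<in> ballot_labelings n r"
  obtains \<Lambda> where "\<Lambda> \<in> noncrossing_colored_partitions n r"
    and "opening_color \<Lambda> = f" and "closing_color \<Lambda> = g"
proof -
  have f: "i \<in> {1..n} \<and> c \<in> {1..r}" if "f i = Some c" for i c
    using assms that by (force simp: ballot_labelings_def intro: ranI)
  have g: "j \<in> {1..n}" if "g j = Some c" for j c
    using assms that by (force simp: ballot_labelings_def)
  have ballot: "ballot (f -` {Some c}) (g -` {Some c})" for c
    using assms by (simp add: ballot_labelings_def)
  obtain M where "\<And>c. noncrossing_matching (f -` {Some c}) (g -` {Some c}) (M c)"
    using ballot_ex1_noncrossing_matching[OF ballot] by metis
  then have M: "arc_diagram (M c)" "noncrossing (M c)"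
    and Domain: "Domain (M c) = f -` {Some c}" and Range: "Range (M c) = g -` {Some c}" for c
    by (auto simp: noncrossing_matching_def)
  have bounds: "i \<in> {1..n} \<and> j \<in> {1..n} \<and> c \<in> {1..r}" if "(i, j) \<in> M c" for i j c
    using that f[of i c] g[of j c] Domain[of c] Range[of c] by blast
  obtain \<Lambda> where \<Lambda>: "\<Lambda> \<in> colored_partitions n r" and color_class: "color_class \<Lambda> = M"
  proof (rule ex_colored_partition_color_class)
    show "M c \<subseteq> {1..n} \<times> {1..n}" "M c \<noteq> {} \<Longrightarrow> c \<in> {1..r}" for c
      using bounds by auto
    show "disjoint_family (\<lambda>c. Domain (M c))" "disjoint_family (\<lambda>c. Range (M c))"
      by (auto simp: Domain Range disjoint_family_on_def)
  qed (rule M)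
  have "cr \<Lambda> < 2"
    using \<Lambda> M color_class cr_less_2_iff[of "{1..n}"] by (auto simp: colored_partitions_def)
  moreover have "opening_color \<Lambda> = f" "closing_color \<Lambda> = g"
    by (rule option_fun_eqI,
        simp add: vimage_opening_color[OF \<Lambda>] vimage_closing_color[OF \<Lambda>] color_class Domain Range)+
  ultimately show thesis
    using that \<Lambda> by (simp add: noncrossing_colored_partitions_def)
qed

theorem bij_betw_opening_closing_color:
  "bij_betw (\<lambda>\<Lambda>. (opening_color \<Lambda>, closing_color \<Lambda>))
     (noncrossing_colored_partitions n r) (ballot_labelings n r)"
proof (rule bij_betw_imageI)
  show "inj_on (\<lambda>\<Lambda>. (opening_color \<Lambda>, closing_color \<Lambda>)) (noncrossing_colored_partitions n r)"
  proof (rule inj_onI)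
    fix \<Lambda> \<Lambda>'
    assume \<Lambda>: "\<Lambda> \<in> noncrossing_colored_partitions n r"
      and \<Lambda>': "\<Lambda>' \<in> noncrossing_colored_partitions n r"
      and eq: "(opening_color \<Lambda>, closing_color \<Lambda>) = (opening_color \<Lambda>', closing_color \<Lambda>')"
    have "color_class \<Lambda> c = color_class \<Lambda>' c" for c
    proof -
      have "ballot (opening_color \<Lambda> -` {Some c}) (closing_color \<Lambda> -` {Some c})"
        using opening_closing_color_in_ballot_labelings[OF \<Lambda>] by (simp add: ballot_labelings_def)
      then show ?thesis
        using noncrossing_matching_color_class[OF \<Lambda>] noncrossing_matching_color_class[OF \<Lambda>'] eq
          ballot_ex1_noncrossing_matching by (metis prod.inject)
    qed
    then show "\<Lambda> = \<Lambda>'"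
      using inj_onD[OF inj_on_color_class] \<Lambda> \<Lambda>'
      unfolding noncrossing_colored_partitions_def by blast
  qed
  show "(\<lambda>\<Lambda>. (opening_color \<Lambda>, closing_color \<Lambda>)) ` noncrossing_colored_partitions n r =
      ballot_labelings n r"
  proof (intro subset_antisym subrelI)
    fix f g assume "(f, g) \<in> ballot_labelings n r"
    then obtain \<Lambda> where "\<Lambda> \<in> noncrossing_colored_partitions n r"
      "opening_color \<Lambda> = f" "closing_color \<Lambda> = g"
      by (rule ex_noncrossing_colored_partition)
    then show "(f, g) \<in> (\<lambda>\<Lambda>. (opening_color \<Lambda>, closing_color \<Lambda>)) `
        noncrossing_colored_partitions n r"
      by blast
  qed (auto intro: opening_closing_color_in_ballot_labelings)
qed

section \<open>Walks\<close>

fun step_opening :: "nat \<Rightarrow> step \<Rightarrow> nat option" where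
  "step_opening r (Up i) = Some i"
| "step_opening r (Down i) = None"
| "step_opening r (Exchange i j) = Some i"
| "step_opening r (Stay c) = (if c \<le> r then Some c else None)"

fun step_closing :: "nat \<Rightarrow> step \<Rightarrow> nat option" where
  "step_closing r (Up i) = None"
| "step_closing r (Down i) = Some i"
| "step_closing r (Exchange i j) = Some j"
| "step_closing r (Stay c) = (if c \<le> r then Some c else None)"

fun step_of_colors :: "nat \<Rightarrow> nat option \<Rightarrow> nat option \<Rightarrow> step" where
  "step_of_colors r (Some i) None = Up i"
| "step_of_colors r None (Some j) = Down j"
| "step_of_colors r (Some i) (Some j) = (if i = j then Stay i else Exchange i j)"
| "step_of_colors r None None = Stay (r + 1)"

lemma step_of_colors_in_steps:
  "set_option a \<subseteq> {1..r} \<Longrightarrow> set_option b \<subseteq> {1..r} \<Longrightarrow> step_of_colors r a b \<in> steps r"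
  by (cases a; cases b) (auto simp: steps_def)

lemma step_opening_step_of_colors:
  "set_option a \<subseteq> {1..r} \<Longrightarrow> step_opening r (step_of_colors r a b) = a"
  by (cases a; cases b) auto

lemma step_closing_step_of_colors:
  "set_option b \<subseteq> {1..r} \<Longrightarrow> step_closing r (step_of_colors r a b) = b"
  by (cases a; cases b) auto

lemma step_of_colors_opening_closing:
  "s \<in> steps r \<Longrightarrow> step_of_colors r (step_opening r s) (step_closing r s) = s"
  by (auto simp: steps_def le_Suc_eq)

lemma
  assumes "s \<in> steps r"
  shows step_opening_range: "step_opening r s = Some c \<Longrightarrow> c \<in> {1..r}"
    and step_closing_range: "step_closing r s = Some c \<Longrightarrow> c \<in> {1..r}"
  using assms by (auto simp: steps_def split: if_splits)

lemma displacement_eq: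
  "displacement s c = of_bool (step_opening r s = Some c) - of_bool (step_closing r s = Some c)"
  by (cases s) (auto simp: unit_vec_def)

lemma position_eq_count_list:
  "position w t c = int (count_list (take t (map (step_opening r) w)) (Some c))
     - int (count_list (take t (map (step_closing r) w)) (Some c))"
proof -
  have "sum_list (map displacement v) c = int (count_list (map (step_opening r) v) (Some c))
      - int (count_list (map (step_closing r) v) (Some c))" for v
    by (induction v) (auto simp: displacement_eq[of _ c r])
  then show ?thesis
    by (simp add: position_def take_map)
qed

lemma position_eq_0_outside:
  assumes "set w \<subseteq> steps r" and "c \<notin> {1..r}"
  shows "position w t c = 0"
proof -
  have "step_opening r s \<noteq> Some c" "step_closing r s \<noteq> Some c" if "s \<in> set w" for s
    using assms that step_opening_range[of s r c] step_closing_range[of s r c] by blast+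
  then have "Some c \<notin> set (take t (map (step_opening r) w))"
    "Some c \<notin> set (take t (map (step_closing r) w))"
    by (fastforce dest!: in_set_takeD)+
  then show ?thesis
    by (simp add: position_eq_count_list[of w t c r])
qed

definition labels_from :: "nat \<Rightarrow> 'a option list \<Rightarrow> nat \<Rightarrow> 'a option" where
  "labels_from a xs i = (if i \<in> {a..<a + length xs} then xs ! (i - a) else None)"

lemma labels_from_nth: "t < length xs \<Longrightarrow> labels_from a xs (a + t) = xs ! t"
  by (simp add: labels_from_def)

lemma dom_labels_from: "dom (labels_from a xs) \<subseteq> {a..<a + length xs}"
  by (auto simp: labels_from_def split: if_splits)

lemma ran_labels_from: "ran (labels_from a xs) \<subseteq> {c. Some c \<in> set xs}"
proof
  fix c assume "c \<in> ran (labels_from a xs)"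
  then obtain i where "i \<in> {a..<a + length xs}" "xs ! (i - a) = Some c"
    by (auto simp: ran_def labels_from_def split: if_splits)
  then show "c \<in> {c. Some c \<in> set xs}"
    using nth_mem[of "i - a" xs] by auto
qed

lemma labels_from_map_upt:
  assumes "dom f \<subseteq> {a..<a + m}"
  shows "labels_from a (map (\<lambda>t. f (a + t)) [0..<m]) = f"
proof
  fix i show "labels_from a (map (\<lambda>t. f (a + t)) [0..<m]) i = f i"
    using assms by (cases "f i") (auto simp: labels_from_def)
qed

lemma card_vimage_labels_from:
  "card (labels_from a xs -` {Some c} \<inter> {..<a + t}) = count_list (take t xs) (Some c)"
proof -
  have "labels_from a xs -` {Some c} \<inter> {..<a + t} =
      (+) a ` {i. i < length (take t xs) \<and> Some c = take t xs ! i}" (is "?L = (+) a ` ?R")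
  proof (intro subset_antisym subsetI)
    fix i assume "i \<in> ?L"
    then have "i - a \<in> ?R" "i = a + (i - a)"
      by (auto simp: labels_from_def split: if_splits)
    then show "i \<in> (+) a ` ?R"
      by blast
  qed (auto simp: labels_from_def)
  then show ?thesis
    by (simp add: card_image count_list_eq_length_filter length_filter_conv_card)
qed

definition walk_opening :: "nat \<Rightarrow> step list \<Rightarrow> nat \<Rightarrow> nat option" where
  "walk_opening r w = labels_from 1 (map (step_opening r) w)"

definition walk_closing :: "nat \<Rightarrow> step list \<Rightarrow> nat \<Rightarrow> nat option" where
  "walk_closing r w = labels_from 2 (map (step_closing r) w)"

lemma
  shows dom_walk_opening: "dom (walk_opening r w) \<subseteq> {1..<Suc (length w)}"
    and dom_walk_closing: "dom (walk_closing r w) \<subseteq> {2..Suc (length w)}"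
    and ran_walk_opening: "set w \<subseteq> steps r \<Longrightarrow> ran (walk_opening r w) \<subseteq> {1..r}"
    and ran_walk_closing: "set w \<subseteq> steps r \<Longrightarrow> ran (walk_closing r w) \<subseteq> {1..r}"
proof -
  show "dom (walk_opening r w) \<subseteq> {1..<Suc (length w)}"
    "dom (walk_closing r w) \<subseteq> {2..Suc (length w)}"
    using dom_labels_from[of 1 "map (step_opening r) w"]
      dom_labels_from[of 2 "map (step_closing r) w"]
    by (auto simp: walk_opening_def walk_closing_def subset_iff)
  have "ran (walk_opening r w) \<subseteq> {c. \<exists>s\<in>set w. step_opening r s = Some c}"
    using ran_labels_from[of 1 "map (step_opening r) w"]
    by (auto simp: walk_opening_def image_iff eq_commute)
  then show "ran (walk_opening r w) \<subseteq> {1..r}" if "set w \<subseteq> steps r"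
    using that step_opening_range by blast
  have "ran (walk_closing r w) \<subseteq> {c. \<exists>s\<in>set w. step_closing r s = Some c}"
    using ran_labels_from[of 2 "map (step_closing r) w"]
    by (auto simp: walk_closing_def image_iff eq_commute)
  then show "ran (walk_closing r w) \<subseteq> {1..r}" if "set w \<subseteq> steps r"
    using that step_closing_range by blast
qed

lemma position_eq_card:
  "position w t c = int (card (walk_opening r w -` {Some c} \<inter> {..<Suc t}))
     - int (card (walk_closing r w -` {Some c} \<inter> {..Suc t}))"
  using card_vimage_labels_from[of 1 "map (step_opening r) w" c t]
    card_vimage_labels_from[of 2 "map (step_closing r) w" c t]
  by (simp add: position_eq_count_list[of w t c r] walk_opening_def walk_closing_def
      lessThan_Suc_atMost)

lemma ballot_walk_iff:
  "ballot (walk_opening r w -` {Some c}) (walk_closing r w -` {Some c}) \<longleftrightarrow>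
     (\<forall>t. 0 \<le> position w t c) \<and> position w (length w) c = 0"
proof -
  let ?X = "walk_opening r w -` {Some c}" and ?Y = "walk_closing r w -` {Some c}"
  have X: "?X \<subseteq> {..<Suc (length w)}" and Y: "?Y \<subseteq> {2..Suc (length w)}"
    using dom_walk_opening[of r w] dom_walk_closing[of r w] by (auto simp: subset_iff dom_def)
  have "finite ?X" "finite ?Y"
    using finite_subset[OF X] finite_subset[OF Y] by simp_all
  moreover have "card ?X = card ?Y \<longleftrightarrow> position w (length w) c = 0"
  proof -
    have "?X \<inter> {..<Suc (length w)} = ?X" "?Y \<inter> {..Suc (length w)} = ?Y"
      using X Y by auto
    then show ?thesis
      by (simp add: position_eq_card[of w _ c r])
  qed
  moreover have "(\<forall>t. card (?Y \<inter> {..t}) \<le> card (?X \<inter> {..<t})) \<longleftrightarrow> (\<forall>t. 0 \<le> position w t c)"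
  proof -
    have "?Y \<inter> {..0} = {}"
      using Y by auto
    then have "(\<forall>t. card (?Y \<inter> {..t}) \<le> card (?X \<inter> {..<t})) \<longleftrightarrow>
        (\<forall>t. card (?Y \<inter> {..Suc t}) \<le> card (?X \<inter> {..<Suc t}))"
      by (metis card.empty le0 not0_implies_Suc)
    then show ?thesis
      by (simp add: position_eq_card[of w _ c r])
  qed
  ultimately show ?thesis
    by (auto simp: ballot_def)
qed

lemma closed_walks_iff_ballot:
  "w \<in> closed_walks r m \<longleftrightarrow> length w = m \<and> set w \<subseteq> steps r \<and>
     (\<forall>c. ballot (walk_opening r w -` {Some c}) (walk_closing r w -` {Some c}))"
proof -
  have "(\<forall>t\<le>m. position w t \<in> orthant r) \<longleftrightarrow> (\<forall>c t. 0 \<le> position w t c)"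
    if w: "length w = m" "set w \<subseteq> steps r"
  proof -
    have "position w t \<in> orthant r \<longleftrightarrow> (\<forall>c. 0 \<le> position w t c)" for t
      unfolding orthant_def mem_Collect_eq using position_eq_0_outside[OF w(2)]
      by (metis order.refl)
    moreover have "position w t = position w (min t m)" for t
      using w(1) by (simp add: position_def min_def)
    ultimately show ?thesis
      by (metis min.cobounded2)
  qed
  then show ?thesis
    unfolding closed_walks_def mem_Collect_eq ballot_walk_iff by (auto simp: fun_eq_iff)
qed

definition walk_of_labelings ::
  "nat \<Rightarrow> nat \<Rightarrow> (nat \<Rightarrow> nat option) \<Rightarrow> (nat \<Rightarrow> nat option) \<Rightarrow> step list" where
  "walk_of_labelings r m f g = map (\<lambda>t. step_of_colors r (f (1 + t)) (g (2 + t))) [0..<m]"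

lemma walk_of_labelings_opening_closing:
  assumes "set w \<subseteq> steps r"
  shows "walk_of_labelings r (length w) (walk_opening r w) (walk_closing r w) = w"
proof (rule nth_equalityI)
  fix t assume "t < length (walk_of_labelings r (length w) (walk_opening r w) (walk_closing r w))"
  then have t: "t < length w"
    by (simp add: walk_of_labelings_def)
  then have "w ! t \<in> steps r"
    using assms by auto
  then show "walk_of_labelings r (length w) (walk_opening r w) (walk_closing r w) ! t = w ! t"
    using t step_of_colors_opening_closing
      labels_from_nth[of t "map (step_opening r) w" 1]
      labels_from_nth[of t "map (step_closing r) w" 2]
    by (simp add: walk_of_labelings_def walk_opening_def walk_closing_def)
qed (simp add: walk_of_labelings_def)

lemma
  assumes "dom f \<subseteq> {1..<Suc m}" "ran f \<subseteq> {1..r}" and "dom g \<subseteq> {2..Suc m}" "ran g \<subseteq> {1..r}"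
  shows length_walk_of_labelings: "length (walk_of_labelings r m f g) = m"
    and set_walk_of_labelings: "set (walk_of_labelings r m f g) \<subseteq> steps r"
    and walk_opening_walk_of_labelings: "walk_opening r (walk_of_labelings r m f g) = f"
    and walk_closing_walk_of_labelings: "walk_closing r (walk_of_labelings r m f g) = g"
proof -
  have f: "set_option (f i) \<subseteq> {1..r}" and g: "set_option (g i) \<subseteq> {1..r}" for i
    using assms(2,4) by (auto intro: ranI)
  show "length (walk_of_labelings r m f g) = m"
    by (simp add: walk_of_labelings_def)
  show "set (walk_of_labelings r m f g) \<subseteq> steps r"
    using step_of_colors_in_steps[OF f g] by (auto simp: walk_of_labelings_def)
  have "dom f \<subseteq> {1..<1 + m}" "dom g \<subseteq> {2..<2 + m}"
    using assms(1,3) by auto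
  then show "walk_opening r (walk_of_labelings r m f g) = f"
    "walk_closing r (walk_of_labelings r m f g) = g"
    using labels_from_map_upt[of f 1 m] labels_from_map_upt[of g 2 m]
    by (simp_all add: walk_opening_def walk_closing_def walk_of_labelings_def comp_def
        step_opening_step_of_colors[OF f] step_closing_step_of_colors[OF g])
qed

theorem bij_betw_walk_opening_closing:
  "bij_betw (\<lambda>w. (walk_opening r w, walk_closing r w))
     (closed_walks r m) (ballot_labelings (Suc m) r)"
proof (rule bij_betw_byWitness[where f' = "\<lambda>(f, g). walk_of_labelings r m f g"])
  show "\<forall>w\<in>closed_walks r m. (case (walk_opening r w, walk_closing r w) of
      (f, g) \<Rightarrow> walk_of_labelings r m f g) = w"
    using walk_of_labelings_opening_closing by (auto simp: closed_walks_iff_ballot)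
  show "\<forall>p\<in>ballot_labelings (Suc m) r.
      (walk_opening r (case p of (f, g) \<Rightarrow> walk_of_labelings r m f g),
      walk_closing r (case p of (f, g) \<Rightarrow> walk_of_labelings r m f g)) = p"
    by (auto simp: ballot_labelings_def
        walk_opening_walk_of_labelings walk_closing_walk_of_labelings)
  show "(\<lambda>w. (walk_opening r w, walk_closing r w)) ` closed_walks r m \<subseteq> ballot_labelings (Suc m) r"
    using dom_walk_opening dom_walk_closing ran_walk_opening ran_walk_closing
    by (fastforce simp: ballot_labelings_def closed_walks_iff_ballot)
  have "walk_of_labelings r m f g \<in> closed_walks r m"
    if "(f, g) \<in> ballot_labelings (Suc m) r" for f g
    using that by (simp add: ballot_labelings_def closed_walks_iff_ballot length_walk_of_labelings
        set_walk_of_labelings walk_opening_walk_of_labelings walk_closing_walk_of_labelings)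
  then show "(\<lambda>(f, g). walk_of_labelings r m f g) ` ballot_labelings (Suc m) r \<subseteq> closed_walks r m"
    by auto
qed

theorem theorem1p6:
  fixes n r :: nat
  assumes "n \<ge> 1" and "r \<ge> 1"
  shows "Cnum n r = card (closed_walks r (n - 1))"
proof -
  have "Cnum n r = card (ballot_labelings n r)"
    using bij_betw_same_card[OF bij_betw_opening_closing_color]
    by (simp add: Cnum_def noncrossing_colored_partitions_def)
  also have "\<dots> = card (closed_walks r (n - 1))"
    using bij_betw_same_card[OF bij_betw_walk_opening_closing[of r "n - 1"]] assms(1) by simp
  finally show ?thesis .
qed

end
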